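(* Let $k\ge 0$ be an integer. The system without delays $(\widetilde\Sigma_k)$, $$\widetilde D_k\dot x_k(t)=\widetilde F_k x_k(t)+\widetilde G_k v_k(t),\qquad y_k(t)=\widetilde H_k x_k(t),$$ is left invertible if and only if the subsystem without delays $(\widetilde E,\widetilde A_0,\widetilde B,\widetilde C)$, $$\widetilde E\dot w(t)=\widetilde A_0 w(t)+\widetilde B u(t),\qquad \widetilde y(t)=\widetilde C w(t),$$ is left invertible.
   Context: Let $U,H,Y$ be real Hilbert spaces, $h>0$, $\alpha\ge 0$, and let $E,A_0,A_1:H\to H$, $B:U\to H$, $C:H\to Y$ be linear operators ($E$ need not be invertible, $A_0,A_1$ may be unbounded, $B,C$ are bounded); for complex $s$ they are extended to the complexified spaces. They define the implicit delay system $E\ddot z(t)+\alpha\dot z(t)+A_0z(t)+A_1z(t-h)=Bu(t)$, $y(t)=Cz(t)$. Put, in block form on $H\times H$, $$\widetilde E=\begin{pmatrix} I&0\\ 0&E\end{pmatrix},\ \widetilde A_0=\begin{pmatrix}0&I\\ -A_0&-\alpha I\end{pmatrix},\ \widetilde A_1=\begin{pmatrix}0&0\\ -A_1&0\end{pmatrix},\ \widetilde B=\begin{pmatrix}0\\ B\end{pmatrix},\ \widetilde C=\begin{pmatrix}0&0\\ C&0\end{pmatrix}.$$ With $w=(z,\dot z)^T$ the delay system reads $\widetilde E\dot w(t)=\widetilde A_0w(t)+\widetilde A_1w(t-h)+\widetilde Bu(t)$, $\widetilde y(t)=\widetilde Cw(t)$. For $k\ge 0$ define $(k+1)\times(k+1)$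 block operators: $\widetilde D_k$, $\widetilde G_k$, $\widetilde H_k$ are block diagonal with all diagonal blocks equal to $\widetilde E$, $\widetilde B$, $\widetilde C$ respectively; $\widetilde F_k$ is block lower bidiagonal with all diagonal blocks equal to $\widetilde A_0$, all blocks immediately below the diagonal equal to $\widetilde A_1$, and all other blocks zero. The vectors are $x_k=(w_0,\dots,w_k)^T$ and $v_k=(u_0,\dots,u_k)^T$. (The system is associated with the delay system by $w_j(t)=w(t+jh)$, $u_j(t)=u(t+jh)$ for $t\in[0,h]$, $w_j(0)=w_{j-1}(h)$, $u_j(0)=u_{j-1}(h)$; for the purpose of left invertibility it is regarded as the classical system without delays given by the quadruple $(\widetilde D_k,\widetilde F_k,\widetilde G_k,\widetilde H_k)$.) A system is left invertible if, for zero initial state, an identically zero output can be generated only by the identically zero input. Signals are studied through their Laplace transforms, assumed to exist. Standing assumption: the transfer functions $\widetilde H_k(s\widetilde D_k-\widetilde F_k)^{-1}\widetilde G_k$ and $\widetilde C(s\widetilde E-\widetilde A_0)^{-1}\widetilde B$ are defined, i.e. $s\widetilde D_k-\widetilde F_k$ and $s\widetilde E-\widetilde A_0$ are invertible for all $s$ in some right half-plane. *)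

theory Defs
  imports "HOL-Analysis.Analysis"
begin

text \<open>A possibly unbounded operator: a domain together with a function whose values outside the
  domain carry no meaning.\<close>

datatype ('a, 'b) linop = Linop (ldom: "'a set") (lapp: "'a \<Rightarrow> 'b")

definition linear_op :: "('a::real_vector, 'b::real_vector) linop \<Rightarrow> bool" where
  "linear_op T \<longleftrightarrow> subspace (ldom T) \<and>
     (\<forall>x\<in>ldom T. \<forall>y\<in>ldom T. lapp T (x + y) = lapp T x + lapp T y) \<and>
     (\<forall>c. \<forall>x\<in>ldom T. lapp T (c *\<^sub>R x) = c *\<^sub>R lapp T x)"

definition zero_op :: "('a, 'b::zero) linop" where
  "zero_op = Linop UNIV (\<lambda>_. 0)"


text \<open>The complexification of a real space \<open>X\<close> is \<open>X \<times> X\<close>, the pair \<open>(x, y)\<close> standing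
  for \<open>x + i y\<close>; \<open>cscale\<close> is its complex scalar multiplication. The norm of the library product
  is the Hilbert norm of the complexification.\<close>

definition cscale :: "complex \<Rightarrow> 'a::real_vector \<times> 'a \<Rightarrow> 'a \<times> 'a" where
  "cscale s z = (Re s *\<^sub>R fst z - Im s *\<^sub>R snd z, Im s *\<^sub>R fst z + Re s *\<^sub>R snd z)"

definition complexify :: "('a, 'b) linop \<Rightarrow> ('a \<times> 'a, 'b \<times> 'b) linop" where
  "complexify T = Linop (ldom T \<times> ldom T) (map_prod (lapp T) (lapp T))"

text \<open>The operator \<open>s D - F\<close>, with its natural domain.\<close>

definition pencil ::
  "complex \<Rightarrow> ('a, 'b::real_vector) linop \<Rightarrow> ('a, 'b) linop \<Rightarrow> ('a \<times> 'a, 'b \<times> 'b) linop" where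
  "pencil s D F = Linop (ldom (complexify D) \<inter> ldom (complexify F))
     (\<lambda>z. cscale s (lapp (complexify D) z) - lapp (complexify F) z)"

definition boundedly_invertible ::
  "('a::real_normed_vector, 'b::real_normed_vector) linop \<Rightarrow> bool" where
  "boundedly_invertible T \<longleftrightarrow> bij_betw (lapp T) (ldom T) UNIV \<and>
     bounded_linear (inv_into (ldom T) (lapp T))"

definition pencil_invertible ::
  "('a::real_normed_vector, 'b::real_normed_vector) linop \<Rightarrow> ('a, 'b) linop \<Rightarrow> bool" where
  "pencil_invertible D F \<longleftrightarrow>
     (\<exists>\<sigma>. \<forall>s. Re s > \<sigma> \<longrightarrow> boundedly_invertible (pencil s D F))"


text \<open>Existence of the Laplace transform on some right half-plane. The Henstock-Kurzweil integral
  over \<open>{0..}\<close> also covers conditionally convergent improper integrals, and, unlike the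
  Bochner integral of the library, needs no separability of the space of values.\<close>

definition laplace_transformable :: "(real \<Rightarrow> 'a::real_normed_vector) \<Rightarrow> bool" where
  "laplace_transformable f \<longleftrightarrow> (\<exists>\<sigma>. \<forall>s. Re s > \<sigma> \<longrightarrow>
     (\<lambda>t. cscale (exp (- s * complex_of_real t)) (f t, 0)) integrable_on {0..})"

text \<open>\<open>x\<close> is a state trajectory on \<open>[0, \<infinity>)\<close>, with zero initial state and input \<open>v\<close>, of
  \<open>D x' = F x + G v\<close>. That \<open>D\<close> may be interchanged with \<open>d/dt\<close> along \<open>x\<close> is
  automatic for bounded \<open>D\<close>; it gives \<open>D x'\<close> its usual meaning when \<open>D\<close> is
  unbounded and not closed. The transforms of \<open>F x\<close>, \<open>G v\<close> and of the output exist as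
  soon as those of \<open>x\<close>, \<open>D x'\<close> and \<open>v\<close> do, \<open>G\<close> and the output operator being
  bounded.\<close>

definition zero_state_trajectory ::
  "('x::real_normed_vector, 'x) linop \<Rightarrow> ('x, 'x) linop \<Rightarrow> ('v::real_normed_vector \<Rightarrow> 'x) \<Rightarrow>
   (real \<Rightarrow> 'x) \<Rightarrow> (real \<Rightarrow> 'v) \<Rightarrow> bool" where
  "zero_state_trajectory D F G x v \<longleftrightarrow> x 0 = 0 \<and>
     (\<exists>x'. (\<forall>t\<ge>0. (x has_vector_derivative x' t) (at t within {0..}) \<and>
              x t \<in> ldom D \<and> x' t \<in> ldom D \<and>
              ((\<lambda>t. lapp D (x t)) has_vector_derivative lapp D (x' t)) (at t within {0..}) \<and>
              x t \<in> ldom F \<and>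
              lapp D (x' t) = lapp F (x t) + G (v t)) \<and>
           laplace_transformable x \<and>
           laplace_transformable (\<lambda>t. lapp D (x' t)) \<and>
           laplace_transformable v)"

definition left_invertible ::
  "('x::real_normed_vector, 'x) linop \<Rightarrow> ('x, 'x) linop \<Rightarrow> ('v::real_normed_vector \<Rightarrow> 'x) \<Rightarrow>
   ('x \<Rightarrow> 'y::real_normed_vector) \<Rightarrow> bool" where
  "left_invertible D F G H \<longleftrightarrow> (\<forall>x v. zero_state_trajectory D F G x v \<longrightarrow>
     (\<forall>t\<ge>0. H (x t) = 0) \<longrightarrow> (\<forall>t\<ge>0. v t = 0))"


definition E_tilde :: "('h, 'h) linop \<Rightarrow> ('h \<times> 'h, 'h \<times> 'h) linop" where
  "E_tilde E = Linop (UNIV \<times> ldom E) (\<lambda>(p, q). (p, lapp E q))"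

definition A0_tilde :: "('h::real_vector, 'h) linop \<Rightarrow> real \<Rightarrow> ('h \<times> 'h, 'h \<times> 'h) linop" where
  "A0_tilde A0 \<alpha> = Linop (ldom A0 \<times> UNIV) (\<lambda>(p, q). (q, - lapp A0 p - \<alpha> *\<^sub>R q))"

definition A1_tilde :: "('h::real_vector, 'h) linop \<Rightarrow> ('h \<times> 'h, 'h \<times> 'h) linop" where
  "A1_tilde A1 = Linop (ldom A1 \<times> UNIV) (\<lambda>(p, q). (0, - lapp A1 p))"

definition B_tilde :: "('u \<Rightarrow> 'h::zero) \<Rightarrow> 'u \<Rightarrow> 'h \<times> 'h" where
  "B_tilde B u = (0, B u)"

definition C_tilde :: "('h \<Rightarrow> 'y::zero) \<Rightarrow> 'h \<times> 'h \<Rightarrow> 'y \<times> 'y" where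
  "C_tilde C = (\<lambda>(p, q). (0, C p))"


text \<open>Block vectors are elements of \<open>'a ^ 'n\<close>, whose norm is the Hilbert norm of the
  direct sum. Block indices \<open>0, \<dots>, k\<close> are attached to the index type by a bijection
  \<open>blk\<close> from \<open>'n\<close> onto \<open>{..k}\<close>.\<close>

definition block_op :: "('n::finite \<Rightarrow> 'n \<Rightarrow> ('a, 'b::comm_monoid_add) linop) \<Rightarrow>
    ('a ^ 'n, 'b ^ 'n) linop" where
  "block_op M = Linop {x. \<forall>i j. x $ j \<in> ldom (M i j)} (\<lambda>x. \<chi> i. \<Sum>j\<in>UNIV. lapp (M i j) (x $ j))"

definition D_block :: "('a, 'b::comm_monoid_add) linop \<Rightarrow> ('a ^ 'n::finite, 'b ^ 'n) linop" where
  "D_block E = block_op (\<lambda>i j. if i = j then E else zero_op)"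

definition F_block :: "('n::finite \<Rightarrow> nat) \<Rightarrow> ('a, 'b::comm_monoid_add) linop \<Rightarrow>
    ('a, 'b) linop \<Rightarrow> ('a ^ 'n, 'b ^ 'n) linop" where
  "F_block blk A0 A1 = block_op (\<lambda>i j.
     if blk i = blk j then A0 else if blk i = blk j + 1 then A1 else zero_op)"

text \<open>The block diagonal operator of an everywhere defined one, used for the input and output
  operators.\<close>

definition block_diag :: "('a \<Rightarrow> 'b) \<Rightarrow> 'a ^ 'n::finite \<Rightarrow> 'b ^ 'n" where
  "block_diag T x = (\<chi> i. T (x $ i))"

end

(* With a zero output the blocks can be treated from the top: if w_0 = ... = w_(i-1) = 0, the i-th
   block row is the subsystem for (w_i, u_i), whose left invertibility gives u_i = 0. To continue one
   needs w_i = 0, i.e. that a zero input forces a zero state. Here the resolvent R(s) of the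
   pencil is used: w = R(s)(s D w - (D w)'), so the integral of exp(-s t) w(t) over [0, b] is
   - R(s)(exp(-s b) D w(b)), which tends to 0 for large s, and Lerch's theorem applies. Conversely,
   a trajectory of the subsystem placed in the last block is a trajectory of the block system. *)

theory Submission
  imports Defs
begin

section \<open>Calculus and improper integrals on a half-line\<close>

lemma integral_has_vector_derivative_atLeast:
  fixes f :: "real \<Rightarrow> 'a::banach"
  assumes "continuous_on {a..} f" and "t \<ge> a"
  shows "((\<lambda>u. integral {a..u} f) has_vector_derivative f t) (at t within {a..})"
proof -
  have "((\<lambda>u. integral {a..u} f) has_vector_derivative f t) (at t within {a..t+1})"
    using assms by (intro integral_has_vector_derivative) (auto intro: continuous_on_subset)
  moreover have "at t within {a..t+1} = at t within {a..}"
    by (rule at_within_nhd[where S = "{..<t+1}"]) auto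
  ultimately show ?thesis by simp
qed

lemma FTC_atLeast:
  fixes f :: "real \<Rightarrow> 'a::banach"
  assumes "\<And>t. t \<ge> a \<Longrightarrow> (f has_vector_derivative f' t) (at t within {a..})" and "a \<le> b"
  shows "(f' has_integral (f b - f a)) {a..b}"
  using assms(2)
proof (rule fundamental_theorem_of_calculus)
  fix t assume "t \<in> {a..b}"
  then show "(f has_vector_derivative f' t) (at t within {a..b})"
    by (intro has_vector_derivative_within_subset[OF assms(1)]) auto
qed

text \<open>Convergence may be only conditional, so the norm of \<open>f\<close> cannot be
  integrated. Instead, the partial integrals stay within 1 of the full integral beyond some
  \<open>B\<close>, and on the compact interval up to \<open>B\<close> they depend continuously on
  the endpoint.\<close>

lemma bounded_partial_integrals:
  fixes f :: "real \<Rightarrow> 'a::banach"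
  assumes "f integrable_on {0..}"
  obtains M where "\<And>b. b \<ge> 0 \<Longrightarrow> norm (integral {0..b} f) \<le> M"
proof -
  obtain I where I: "(f has_integral I) {0..}" using assms by blast
  \<comment> \<open>The description of the integral by large boxes applies only to a domain that is
    not itself a box.\<close>
  have "\<not> (\<exists>a b. {0::real..} = cbox a b)"
    by (auto simp: set_eq_iff) (metis abs_ge_self abs_ge_zero le_cases less_add_one not_less order_trans)
  from has_integral_altD[OF I this zero_less_one] obtain B where "B > 0" and
    B: "\<And>a b. ball 0 B \<subseteq> cbox a b \<Longrightarrow> \<exists>z. ((\<lambda>x. if x \<in> {0..} then f x else 0) has_integral z) (cbox a b)
         \<and> norm (z - I) < 1" by blast
  have large: "norm (integral {0..b} f) \<le> norm I + 1" if "b \<ge> B" for b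
  proof -
    have "ball 0 B \<subseteq> cbox (-b) b" using that by (auto simp: dist_real_def)
    from B[OF this] obtain z where
      z: "((\<lambda>x. if x \<in> {0..} then f x else 0) has_integral z) (cbox (-b) b)" "norm (z - I) < 1"
      by blast
    have "{-b..b} \<inter> {0..} = {0..b}" using that \<open>B > 0\<close> by auto
    with z(1) have "(f has_integral z) {0..b}"
      by (simp only: has_integral_restrict_Int interval_cbox[symmetric] cbox_interval Int_commute)
    then have "integral {0..b} f = z" by (rule integral_unique)
    with z(2) norm_triangle_ineq2[of z I] show ?thesis by simp
  qed
  have "f integrable_on {0..B}"
    using assms integrable_on_subinterval[of f "{0..}" 0 B] by auto
  then have "continuous_on {0..B} (\<lambda>b. integral {0..b} f)"
    by (rule indefinite_integral_continuous_1)
  then have "bounded ((\<lambda>b. integral {0..b} f) ` {0..B})"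
    by (intro compact_imp_bounded compact_continuous_image) auto
  then obtain K where K: "\<And>b. b \<in> {0..B} \<Longrightarrow> norm (integral {0..b} f) \<le> K"
    unfolding bounded_iff by (metis imageI)
  show thesis
  proof
    fix b :: real assume "b \<ge> 0"
    then show "norm (integral {0..b} f) \<le> max K (norm I + 1)"
      using large[of b] K[of b] by (cases "b \<le> B") auto
  qed
qed

text \<open>Integration by parts turns conditional convergence of the weighted integral of
  \<open>q\<close> into a pointwise growth bound for \<open>p\<close>. With \<open>p\<close> taken
  as \<open>D\<close> applied to the state, this later makes the boundary term of the transformed
  equation vanish for larger exponents.\<close>

lemma antiderivative_exp_bound:
  fixes p :: "real \<Rightarrow> 'a::banach"
  assumes p: "\<And>t. t \<ge> 0 \<Longrightarrow> (p has_vector_derivative q t) (at t within {0..})" and "p 0 = 0"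
    and "s > 0" and int: "(\<lambda>t. exp (- s * t) *\<^sub>R q t) integrable_on {0..}"
  obtains M where "\<And>t. t \<ge> 0 \<Longrightarrow> norm (p t) \<le> M * exp (s * t)"
proof -
  define Q where "Q b = integral {0..b} (\<lambda>t. exp (- s * t) *\<^sub>R q t)" for b
  obtain M where M: "\<And>b. b \<ge> 0 \<Longrightarrow> norm (Q b) \<le> M"
    using bounded_partial_integrals[OF int] unfolding Q_def by blast
  define g where "g t = exp (- s * t) *\<^sub>R p t" for t
  have g': "(g has_vector_derivative exp (- s * t) *\<^sub>R q t - s *\<^sub>R g t) (at t within {0..})"
    if "t \<ge> 0" for t
    unfolding g_def by (rule derivative_eq_intros p that refl)+ (simp add: algebra_simps)
  have contg: "continuous_on {0..} g"
    using g' by (auto simp: continuous_on_eq_continuous_within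
        intro: has_vector_derivative_continuous)
  define I where "I b = integral {0..b} g" for b
  have I': "(I has_vector_derivative g t) (at t within {0..})" if "t \<ge> 0" for t
    unfolding I_def using integral_has_vector_derivative_atLeast[OF contg that] .
  have gI: "g b = Q b - s *\<^sub>R I b" if "b \<ge> 0" for b
  proof -
    have "g integrable_on {0..b}"
      using contg by (intro integrable_continuous_real) (auto intro: continuous_on_subset)
    then have "((\<lambda>t. s *\<^sub>R g t) has_integral s *\<^sub>R I b) {0..b}"
      unfolding I_def by (intro has_integral_cmul) blast
    from has_integral_add[OF FTC_atLeast[OF g' that] this]
    have "((\<lambda>t. exp (- s * t) *\<^sub>R q t) has_integral (g b + s *\<^sub>R I b)) {0..b}"
      using \<open>p 0 = 0\<close> by (simp add: g_def)
    then show ?thesis unfolding Q_def by (simp add: integral_unique)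
  qed
  \<comment> \<open>\<open>q\<close> need not be continuous, so it is eliminated in favour of the linear equation
    \<open>I' = Q - s I\<close> with bounded right-hand side \<open>Q\<close>.\<close>
  have bound: "norm (I b) \<le> M / s" if "b \<ge> 0" for b
  proof (cases "b = 0")
    case True then show ?thesis using M[of 0] \<open>s > 0\<close> by (simp add: I_def Q_def)
  next
    case False
    \<comment> \<open>The integrating factor \<open>exp (s * t)\<close> removes the term
      \<open>- s I\<close>. What is left is dominated by \<open>M * exp (s * t)\<close>, the
      derivative of \<open>M / s * exp (s * t)\<close>.\<close>
    have e': "((\<lambda>t. exp (s * t) *\<^sub>R I t) has_vector_derivative exp (s * t) *\<^sub>R Q t) (at t within {0..})"
      if "t \<ge> 0" for t
      by (rule derivative_eq_intros I' that refl)+ (simp add: algebra_simps gI[OF that])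
    have "norm (exp (s * b) *\<^sub>R I b - exp (s * 0) *\<^sub>R I 0) \<le> M / s * exp (s * b) - M / s * exp (s * 0)"
    proof (rule differentiable_bound_general)
      show "0 < b" using that False by simp
      show "continuous_on {0..b} (\<lambda>t. exp (s * t) *\<^sub>R I t)"
        using e' by (intro continuous_on_subset[of "{0..}" _ "{0..b}"])
          (auto simp: continuous_on_eq_continuous_within intro: has_vector_derivative_continuous)
      show "continuous_on {0..b} (\<lambda>t. M / s * exp (s * t))" by (intro continuous_intros)
      show "((\<lambda>t. exp (s * t) *\<^sub>R I t) has_vector_derivative exp (s * t) *\<^sub>R Q t) (at t)"
        if "0 < t" "t < b" for t
        using e'[of t] that at_within_interior[of t "{0..}"] by simp
      show "((\<lambda>t. M / s * exp (s * t)) has_vector_derivative M * exp (s * t)) (at t)" for t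
        using \<open>s > 0\<close> by (auto intro!: derivative_eq_intros simp: has_real_derivative_iff_has_vector_derivative[symmetric])
      show "norm (exp (s * t) *\<^sub>R Q t) \<le> M * exp (s * t)" if "0 < t" for t
        using M[of t] that by (simp add: mult.commute)
    qed
    \<comment> \<open>The sign of \<open>M\<close> allows the subtracted term \<open>M / s\<close>
      to be dropped.\<close>
    moreover have "M \<ge> 0" using M[of 0] by (simp add: Q_def)
    ultimately have "exp (s * b) * norm (I b) \<le> exp (s * b) * (M / s)"
      using \<open>s > 0\<close> by (simp add: I_def mult.commute) (smt (verit) divide_nonneg_pos)
    then show ?thesis by (simp only: mult_le_cancel_left_pos exp_gt_zero)
  qed
  show thesis
  proof
    fix t :: real assume "t \<ge> 0"
    have "norm (g t) \<le> norm (Q t) + s * norm (I t)"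
      unfolding gI[OF \<open>t \<ge> 0\<close>] using norm_triangle_ineq4[of "Q t" "s *\<^sub>R I t"] \<open>s > 0\<close> by simp
    also have "\<dots> \<le> M + s * (M / s)"
      using M bound \<open>t \<ge> 0\<close> \<open>s > 0\<close> by (intro add_mono mult_left_mono) auto
    finally have "norm (g t) \<le> 2 * M" using \<open>s > 0\<close> by simp
    then show "norm (p t) \<le> 2 * M * exp (s * t)"
      by (simp add: g_def exp_minus field_simps)
  qed
qed

section \<open>Lerch's uniqueness theorem for conditionally convergent Laplace integrals\<close>

text \<open>Transforms at the points \<open>s + 1\<close>, \<open>s + 2\<close>, ... yield vanishing
  moments of an antiderivative against powers of \<open>exp (- t)\<close>. Under the substitution of
  \<open>x\<close> for \<open>exp (- t)\<close> this is a polynomial moment problem on the unit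
  interval; once the antiderivative is zero, so is its derivative.\<close>

lemma Lerch_real:
  fixes g :: "real \<Rightarrow> real"
  assumes cont: "continuous_on {0..} g"
    and lim: "\<And>s. s > \<sigma> \<Longrightarrow> ((\<lambda>b. integral {0..b} (\<lambda>t. exp (- s * t) * g t)) \<longlongrightarrow> 0) at_top"
    and "t \<ge> 0"
  shows "g t = 0"
proof -
  define s where "s = \<sigma> + 1"
  define F where "F b = integral {0..b} (\<lambda>t. exp (- s * t) * g t)" for b
  \<comment> \<open>Passing to the antiderivative \<open>F\<close> makes the integrals absolutely convergent: \<open>F\<close> is bounded
    and vanishes at infinity, so Weierstrass applies to \<open>F \<circ> (- ln)\<close> on \<open>[0, 1]\<close>.\<close>
  have F0: "F 0 = 0" by (simp add: F_def)
  have Flim: "(F \<longlongrightarrow> 0) at_top"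
    unfolding F_def by (rule lim) (simp add: s_def)
  have F': "(F has_vector_derivative exp (- s * t) * g t) (at t within {0..})" if "t \<ge> 0" for t
    unfolding F_def
    by (rule integral_has_vector_derivative_atLeast[OF _ that]) (intro continuous_intros cont)
  have contF: "continuous_on {0..} F"
    using F' by (auto simp: continuous_on_eq_continuous_within
        intro: has_vector_derivative_continuous)
  have contF': "continuous_on {0..b} F" for b
    by (rule continuous_on_subset[OF contF]) auto
  \<comment> \<open>The exponent is \<open>Suc n\<close> because one factor \<open>exp (- t)\<close>
    is the Jacobian of the substitution; the remaining \<open>n\<close> factors form the monomial.
    It also keeps the shift \<open>m\<close> positive, even for \<open>n = 0\<close>.\<close>
  have moment: "((\<lambda>b. integral {0..b} (\<lambda>t. exp (- t) ^ Suc n * F t)) \<longlongrightarrow> 0) at_top" for n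
  proof -
    define m where "m = real (Suc n)"
    have "m > 0" by (simp add: m_def)
    have pow: "exp (- t) ^ Suc n = exp (- m * t)" for t :: real
      unfolding m_def by (subst exp_of_nat_mult[symmetric]) (simp add: algebra_simps)
    \<comment> \<open>Integration by parts trades \<open>F\<close> for \<open>g\<close> at the
      exponent \<open>s + m\<close>, which still exceeds \<open>\<sigma>\<close>.\<close>
    have eq: "integral {0..b} (\<lambda>t. exp (- m * t) * F t) =
        (integral {0..b} (\<lambda>t. exp (- (s + m) * t) * g t) - exp (- m * b) * F b) / m"
      if "b \<ge> 0" for b
    proof -
      have 1: "((\<lambda>t. exp (- (s + m) * t) * g t - m * (exp (- m * t) * F t)) has_integral
          exp (- m * b) * F b - exp (- m * 0) * F 0) {0..b}"
      proof (rule FTC_atLeast[OF _ that])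
        fix t :: real assume "t \<ge> 0"
        have "exp (- (s + m) * t) = exp (- m * t) * exp (- s * t)"
          by (simp add: exp_add[symmetric] algebra_simps)
        then show "((\<lambda>t. exp (- m * t) * F t) has_vector_derivative
            exp (- (s + m) * t) * g t - m * (exp (- m * t) * F t)) (at t within {0..})"
          using F'[OF \<open>t \<ge> 0\<close>]
          by (auto simp: has_real_derivative_iff_has_vector_derivative[symmetric] algebra_simps
              intro!: derivative_eq_intros)
      qed
      have 2: "((\<lambda>t. m * (exp (- m * t) * F t)) has_integral
          m * integral {0..b} (\<lambda>t. exp (- m * t) * F t)) {0..b}"
        by (intro has_integral_mult_right integrable_integral integrable_continuous_real
            continuous_intros contF')
      from has_integral_add[OF 1 2]
      have "integral {0..b} (\<lambda>t. exp (- (s + m) * t) * g t) =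
          exp (- m * b) * F b + m * integral {0..b} (\<lambda>t. exp (- m * t) * F t)"
        by (simp add: F0 integral_unique)
      then show ?thesis using \<open>m > 0\<close> by (simp add: field_simps)
    qed
    have "filterlim (\<lambda>b. m * b) at_top at_top"
      using \<open>m > 0\<close> by (intro filterlim_tendsto_pos_mult_at_top[OF tendsto_const] filterlim_ident)
    then have "((\<lambda>b. exp (- (m * b))) \<longlongrightarrow> 0) at_top"
      by (intro filterlim_compose[OF exp_at_bot] filterlim_compose[OF filterlim_uminus_at_bot_at_top])
    then have "((\<lambda>b. exp (- m * b) * F b) \<longlongrightarrow> 0 * 0) at_top"
      by (intro tendsto_mult Flim) simp
    then have "((\<lambda>b. (integral {0..b} (\<lambda>t. exp (- (s + m) * t) * g t) - exp (- m * b) * F b) / m)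
        \<longlongrightarrow> (0 - 0 * 0) / m) at_top"
      using \<open>m > 0\<close> by (intro tendsto_divide tendsto_diff lim tendsto_const) (auto simp: s_def)
    then have "((\<lambda>b. integral {0..b} (\<lambda>t. exp (- m * t) * F t)) \<longlongrightarrow> (0 - 0 * 0) / m) at_top"
      by (rule Lim_transform_eventually)
        (use eventually_ge_at_top[of 0] in \<open>eventually_elim, simp only: eq\<close>)
    then show ?thesis unfolding pow by simp
  qed
  \<comment> \<open>The point 0 corresponds to infinite time; the value 0 there is the limit of
    \<open>F\<close>, which makes \<open>G\<close> continuous on the closed unit interval.\<close>
  define G where "G x = (if x \<le> 0 then 0 else F (- ln x))" for x
  have GF: "G (exp (- t)) = F t" for t by (simp add: G_def not_le)
  have contG: "continuous_on {0..1} G"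
    unfolding continuous_on_eq_continuous_within
  proof
    fix x :: real assume x: "x \<in> {0..1}"
    show "continuous (at x within {0..1}) G"
    proof (cases "x = 0")
      case True
      have "(G \<longlongrightarrow> 0) (at 0 within {0..1})"
      proof (rule tendstoI)
        fix e :: real assume "e > 0"
        from tendstoD[OF Flim this] obtain T where T: "\<And>t. t \<ge> T \<Longrightarrow> \<bar>F t\<bar> < e"
          by (auto simp: eventually_at_top_linorder)
        show "\<forall>\<^sub>F x in at 0 within {0..1}. dist (G x) 0 < e"
          unfolding eventually_at
        proof (intro exI[of _ "exp (- T)"] conjI ballI impI)
          fix x :: real assume x: "x \<in> {0..1}" "x \<noteq> 0 \<and> dist x 0 < exp (- T)"
          then have "ln x < ln (exp (- T))" by (subst ln_less_cancel_iff) auto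
          then have "- ln x \<ge> T" by simp
          with x T[of "- ln x"] show "dist (G x) 0 < e" by (auto simp: G_def)
        qed simp
      qed
      then show ?thesis using True by (simp add: continuous_within G_def)
    next
      case False
      have "continuous_on {0<..1} (\<lambda>x. F (- ln x))"
        by (rule continuous_on_compose2[OF contF]) (auto intro!: continuous_intros)
      then have "continuous_on {0<..1} G"
        by (rule continuous_on_eq) (auto simp: G_def)
      with x False have "continuous (at x within {0<..1}) G"
        by (auto simp: continuous_on_eq_continuous_within)
      moreover have "at x within {0<..1} = at x within {0..1}"
        by (rule at_within_nhd[where S = "{0<..}"]) (use x False in auto)
      ultimately show ?thesis by simp
    qed
  qed
  have "bounded (G ` {0..1})"
    by (intro compact_imp_bounded compact_continuous_image contG) auto
  then obtain M where M: "\<And>x. x \<in> {0..1} \<Longrightarrow> \<bar>G x\<bar> \<le> M"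
    unfolding bounded_iff by (metis imageI real_norm_def)
  have MF: "\<bar>F t\<bar> \<le> M" if "t \<ge> 0" for t
    using M[of "exp (- t)"] that by (simp add: GF)
  have "M \<ge> 0" using MF[of 0] by simp
  \<comment> \<open>One factor of the square of \<open>F\<close> is replaced by a polynomial in
    \<open>exp (- t)\<close> at uniform cost \<open>e\<close>. The other factor is at most
    \<open>M\<close> and the weight has integral at most 1, so the error is at most
    \<open>e * M\<close>, while the polynomial part \<open>P b\<close> tends to 0.\<close>
  have small: "integral {0..c} (\<lambda>t. exp (- t) * (F t)\<^sup>2) \<le> e * M" if "c \<ge> 0" "e > 0" for c e
  proof -
    obtain h where h: "real_polynomial_function h" "\<And>x. x \<in> {0..1} \<Longrightarrow> \<bar>G x - h x\<bar> < e"
      using Stone_Weierstrass_real_polynomial_function[OF _ contG \<open>e > 0\<close>] by blast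
    from h(1) obtain a n where hsum: "h = (\<lambda>x. \<Sum>i\<le>n. a i * x ^ i)"
      by (auto simp: real_polynomial_function_iff_sum)
    define P where "P b = integral {0..b} (\<lambda>t. exp (- t) * h (exp (- t)) * F t)" for b
    have conth: "continuous_on {0..b} (\<lambda>t. h (exp (- t)))" for b
      unfolding hsum by (intro continuous_intros)
    have "P b = (\<Sum>i\<le>n. a i * integral {0..b} (\<lambda>t. exp (- t) ^ Suc i * F t))" for b
    proof -
      have "P b = integral {0..b} (\<lambda>t. \<Sum>i\<le>n. a i * (exp (- t) ^ Suc i * F t))"
        unfolding P_def hsum
        by (simp add: sum_distrib_left sum_distrib_right mult_ac)
      also have "\<dots> = (\<Sum>i\<le>n. integral {0..b} (\<lambda>t. a i * (exp (- t) ^ Suc i * F t)))"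
        by (intro integral_sum integrable_continuous_real continuous_intros contF') auto
      finally show ?thesis by simp
    qed
    moreover have "((\<lambda>b. \<Sum>i\<le>n. a i * integral {0..b} (\<lambda>t. exp (- t) ^ Suc i * F t))
        \<longlongrightarrow> (\<Sum>i\<le>n. a i * 0)) at_top"
      by (intro tendsto_sum tendsto_mult tendsto_const moment)
    ultimately have "((\<lambda>b. P b + e * M) \<longlongrightarrow> 0 + e * M) at_top"
      by (intro tendsto_add tendsto_const) simp
    moreover have "integral {0..c} (\<lambda>t. exp (- t) * (F t)\<^sup>2) \<le> P b + e * M" if "b \<ge> c" for b
    proof -
      have "b \<ge> 0" using that \<open>c \<ge> 0\<close> by simp
      \<comment> \<open>The integrand is nonnegative, so the fixed window up to \<open>c\<close> may
        be enlarged to \<open>b\<close>, which is then sent to infinity.\<close>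
      have "integral {0..c} (\<lambda>t. exp (- t) * (F t)\<^sup>2) \<le> integral {0..b} (\<lambda>t. exp (- t) * (F t)\<^sup>2)"
        using that by (intro integral_subset_le integrable_continuous_real continuous_intros contF') auto
      also have "\<dots> \<le> integral {0..b} (\<lambda>t. exp (- t) * h (exp (- t)) * F t + e * M * exp (- t))"
      proof (intro integral_le integrable_continuous_real continuous_intros contF' conth)
        fix t assume "t \<in> {0..b}"
        then have "\<bar>F t - h (exp (- t))\<bar> * \<bar>F t\<bar> \<le> e * M"
          using h(2)[of "exp (- t)"] MF[of t] \<open>e > 0\<close>
          by (intro mult_mono) (auto simp: GF)
        then have "(F t - h (exp (- t))) * F t \<le> e * M"
          by (metis abs_le_D1 abs_mult)
        then have "exp (- t) * ((F t - h (exp (- t))) * F t) \<le> exp (- t) * (e * M)" by simp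
        then show "exp (- t) * (F t)\<^sup>2 \<le> exp (- t) * h (exp (- t)) * F t + e * M * exp (- t)"
          by (simp add: algebra_simps power2_eq_square)
      qed
      also have "\<dots> = P b + e * M * integral {0..b} (\<lambda>t. exp (- t))"
        unfolding P_def
        by (subst integral_add) (auto intro!: integrable_continuous_real continuous_intros contF' conth)
      also have "((\<lambda>t. exp (- t)) has_integral - exp (- b) - - exp (- 0)) {0..b}"
        using \<open>b \<ge> 0\<close> by (intro fundamental_theorem_of_calculus)
         (auto simp: has_real_derivative_iff_has_vector_derivative[symmetric] intro!: derivative_eq_intros)
      then have "integral {0..b} (\<lambda>t. exp (- t)) \<le> 1" by (simp add: integral_unique)
      then have "P b + e * M * integral {0..b} (\<lambda>t. exp (- t)) \<le> P b + e * M"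
        using \<open>e > 0\<close> \<open>M \<ge> 0\<close> by (simp add: mult_left_le)
      finally show ?thesis by simp
    qed
    ultimately have "integral {0..c} (\<lambda>t. exp (- t) * (F t)\<^sup>2) \<le> 0 + e * M"
      by (intro tendsto_lowerbound[of "\<lambda>b. P b + e * M" _ at_top])
         (auto simp: eventually_at_top_linorder)
    then show ?thesis by simp
  qed
  have Fzero: "F t = 0" if "t \<ge> 0" for t
  proof -
    \<comment> \<open>The endpoint \<open>t + 1\<close> keeps the interval nondegenerate when
      \<open>t = 0\<close>.\<close>
    define J where "J = integral {0..t+1} (\<lambda>t. exp (- t) * (F t)\<^sup>2)"
    have "J \<le> 0 + e" if "e > 0" for e
    proof -
      \<comment> \<open>The denominator is \<open>M + 1\<close> because \<open>M\<close> may be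
        0.\<close>
      have "J \<le> e / (M + 1) * M"
        unfolding J_def using \<open>M \<ge> 0\<close> \<open>t \<ge> 0\<close> that by (intro small) auto
      also have "\<dots> \<le> e" using \<open>M \<ge> 0\<close> that by (simp add: field_simps)
      finally show ?thesis by simp
    qed
    then have "J \<le> 0" by (rule field_le_epsilon)
    moreover have "J \<ge> 0" unfolding J_def by (intro integral_nonneg integrable_continuous_real continuous_intros contF') auto
    ultimately have "J = 0" by simp
    then have "\<forall>u\<in>{0..t+1}. exp (- u) * (F u)\<^sup>2 = 0"
      unfolding J_def using that
      by (subst (asm) integral_eq_0_iff) (auto intro!: continuous_intros contF')
    then show ?thesis using that by simp
  qed
  \<comment> \<open>On the half-line \<open>F\<close> agrees with the zero function, so uniqueness
    of one-sided derivatives forces its derivative, the weighted \<open>g\<close>, to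
    vanish.\<close>
  have "((\<lambda>_. 0) has_vector_derivative exp (- s * t) * g t) (at t within {0..})"
    by (rule has_vector_derivative_transform[OF _ _ F'[OF \<open>t \<ge> 0\<close>]]) (use Fzero \<open>t \<ge> 0\<close> in auto)
  then have "exp (- s * t) * g t = 0"
    using \<open>t \<ge> 0\<close>
    by (intro vector_derivative_unique_within_closed_interval[of t "t + 1" t "\<lambda>_. 0"])
       (auto intro: has_vector_derivative_within_subset)
  then show ?thesis by simp
qed

text \<open>The inner product with a fixed vector \<open>c\<close> commutes with integration and
  reduces the claim to the scalar case; the choice of \<open>f t\<close> for \<open>c\<close> then
  finishes.\<close>

lemma Lerch:
  fixes f :: "real \<Rightarrow> 'a::{real_inner, banach}"
  assumes cont: "continuous_on {0..} f"
    and lim: "\<And>s. s > \<sigma> \<Longrightarrow> ((\<lambda>b. integral {0..b} (\<lambda>t. exp (- s * t) *\<^sub>R f t)) \<longlongrightarrow> 0) at_top"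
    and "t \<ge> 0"
  shows "f t = 0"
proof -
  have "f t \<bullet> c = 0" for c
  proof (rule Lerch_real[where g = "\<lambda>t. f t \<bullet> c"])
    show "continuous_on {0..} (\<lambda>t. f t \<bullet> c)" by (intro continuous_intros cont)
    fix s assume "s > \<sigma>"
    have eq: "integral {0..b} (\<lambda>t. exp (- s * t) *\<^sub>R f t) \<bullet> c = integral {0..b} (\<lambda>t. exp (- s * t) * (f t \<bullet> c))" for b
    proof -
      have "(\<lambda>t. exp (- s * t) *\<^sub>R f t) integrable_on {0..b}"
        by (intro integrable_continuous_real continuous_intros continuous_on_subset[OF cont]) auto
      from integral_linear[OF this bounded_linear_inner_left[of c]]
      show ?thesis by (simp add: o_def)
    qed
    show "((\<lambda>b. integral {0..b} (\<lambda>t. exp (- s * t) * (f t \<bullet> c))) \<longlongrightarrow> 0) at_top"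
      using tendsto_inner[OF lim[OF \<open>s > \<sigma>\<close>] tendsto_const[of c]] unfolding eq by simp
  qed (rule \<open>t \<ge> 0\<close>)
  from this[of "f t"] show ?thesis by simp
qed

section \<open>Linear operators, Laplace transforms and the resolvent at real points\<close>

lemma linear_op_0:
  assumes "linear_op T"
  shows "0 \<in> ldom T" and "lapp T 0 = 0"
proof -
  show "0 \<in> ldom T" using assms by (auto simp: linear_op_def subspace_0)
  then have "lapp T (0 *\<^sub>R 0) = 0 *\<^sub>R lapp T 0" using assms by (metis linear_op_def)
  then show "lapp T 0 = 0" by simp
qed

text \<open>Acting on both components of the complexification, \<open>T\<close> commutes with
  \<open>cscale\<close> and with the integral. This serves for the projection to a block and for the
  embedding of one.\<close>

lemma laplace_transformable_linear:
  assumes f: "laplace_transformable f" and T: "bounded_linear T"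
  shows "laplace_transformable (\<lambda>t. T (f t))"
proof -
  interpret T: bounded_linear T by fact
  have "bounded_linear (map_prod T T)"
    unfolding map_prod_def case_prod_unfold
    by (intro bounded_linear_Pair bounded_linear_compose[OF T] bounded_linear_fst bounded_linear_snd)
  from integrable_linear[OF _ this]
  have "(\<lambda>t. cscale (exp (- s * complex_of_real t)) (T (f t), 0)) integrable_on {0..}"
    if "(\<lambda>t. cscale (exp (- s * complex_of_real t)) (f t, 0)) integrable_on {0..}" for s
    using that by (fastforce simp: o_def cscale_def T.scaleR T.zero)
  with f show ?thesis
    unfolding laplace_transformable_def by blast
qed

text \<open>At real \<open>s\<close> the first component of the complexified integrand is the plain
  weighted function. The growth bound and Lerch's theorem use only such \<open>s\<close>.\<close>

lemma laplace_transformable_real: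
  assumes "laplace_transformable f"
  obtains \<sigma> where "\<And>s. s > \<sigma> \<Longrightarrow> (\<lambda>t. exp (- s * t) *\<^sub>R f t) integrable_on {0..}"
proof -
  obtain \<sigma> where \<sigma>: "\<And>s. Re s > \<sigma> \<Longrightarrow>
      (\<lambda>t. cscale (exp (- s * complex_of_real t)) (f t, 0)) integrable_on {0..}"
    using assms unfolding laplace_transformable_def by blast
  show thesis
  proof
    fix s assume "s > \<sigma>"
    then have "(\<lambda>t. cscale (exp (- complex_of_real s * complex_of_real t)) (f t, 0)) integrable_on {0..}"
      by (intro \<sigma>) simp
    from integrable_linear[OF this bounded_linear_fst]
    show "(\<lambda>t. exp (- s * t) *\<^sub>R f t) integrable_on {0..}"
      by (simp add: o_def cscale_def Re_exp)
  qed
qed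

text \<open>At real \<open>s\<close> the pencil does not mix real and imaginary parts, so its
  inverse, restricted to vectors \<open>(y, 0)\<close> and followed by \<open>fst\<close>, inverts
  \<open>s D - F\<close> on the real space.\<close>

lemma real_resolvent:
  assumes "linear_op D" and "linear_op F" and "boundedly_invertible (pencil (of_real s) D F)"
  obtains R where "bounded_linear R"
    and "\<And>x. x \<in> ldom D \<Longrightarrow> x \<in> ldom F \<Longrightarrow> R (s *\<^sub>R lapp D x - lapp F x) = x"
proof
  define P where "P = pencil (of_real s) D F"
  define R where "R y = fst (inv_into (ldom P) (lapp P) (y, 0))" for y
  have P: "inj_on (lapp P) (ldom P)" "bounded_linear (inv_into (ldom P) (lapp P))"
    using assms(3) by (auto simp: boundedly_invertible_def P_def bij_betw_def)
  show "bounded_linear R"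
    unfolding R_def
    by (intro bounded_linear_compose[OF bounded_linear_fst] bounded_linear_compose[OF P(2)]
        bounded_linear_Pair bounded_linear_ident bounded_linear_zero)
  fix x assume x: "x \<in> ldom D" "x \<in> ldom F"
  have "(x, 0) \<in> ldom P"
    using x assms by (auto simp: P_def pencil_def complexify_def linear_op_0)
  moreover have "lapp P (x, 0) = (s *\<^sub>R lapp D x - lapp F x, 0)"
    using assms by (simp add: P_def pencil_def complexify_def cscale_def linear_op_0)
  ultimately show "R (s *\<^sub>R lapp D x - lapp F x) = x"
    unfolding R_def using inv_into_f_f[OF P(1)] by (metis fst_conv)
qed

lemma zero_state_trajectoryE:
  assumes "zero_state_trajectory D F G x v"
  obtains x' where "x 0 = 0"
    and "\<And>t. t \<ge> 0 \<Longrightarrow> (x has_vector_derivative x' t) (at t within {0..})"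
    and "\<And>t. t \<ge> 0 \<Longrightarrow> x t \<in> ldom D" and "\<And>t. t \<ge> 0 \<Longrightarrow> x' t \<in> ldom D"
    and "\<And>t. t \<ge> 0 \<Longrightarrow> x t \<in> ldom F"
    and "\<And>t. t \<ge> 0 \<Longrightarrow>
        ((\<lambda>t. lapp D (x t)) has_vector_derivative lapp D (x' t)) (at t within {0..})"
    and "\<And>t. t \<ge> 0 \<Longrightarrow> lapp D (x' t) = lapp F (x t) + G (v t)"
    and "laplace_transformable x" and "laplace_transformable (\<lambda>t. lapp D (x' t))"
    and "laplace_transformable v"
  using assms unfolding zero_state_trajectory_def by (elim conjE exE) (rule that, blast+)

section \<open>Zero input forces zero state\<close>

text \<open>As \<open>D\<close> may be singular, the equation cannot be solved for the derivative of
  the state, and uniqueness has to come from the resolvent.\<close>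

lemma zero_input_zero_state:
  fixes D F :: "('x::{real_inner, banach}, 'x) linop"
  assumes lin: "linear_op D" "linear_op F" and inv: "pencil_invertible D F"
    and traj: "zero_state_trajectory D F G x v"
    and input: "\<And>t. t \<ge> 0 \<Longrightarrow> G (v t) = 0" and "t \<ge> 0"
  shows "x t = 0"
proof -
  obtain x' where x0: "x 0 = 0"
    and x': "\<And>t. t \<ge> 0 \<Longrightarrow> (x has_vector_derivative x' t) (at t within {0..})"
    and dom: "\<And>t. t \<ge> 0 \<Longrightarrow> x t \<in> ldom D" "\<And>t. t \<ge> 0 \<Longrightarrow> x t \<in> ldom F"
    and Dx': "\<And>t. t \<ge> 0 \<Longrightarrow>
        ((\<lambda>t. lapp D (x t)) has_vector_derivative lapp D (x' t)) (at t within {0..})"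
    and Gv: "\<And>t. t \<ge> 0 \<Longrightarrow> lapp D (x' t) = lapp F (x t) + G (v t)"
    and lap: "laplace_transformable (\<lambda>t. lapp D (x' t))"
    using traj by (rule zero_state_trajectoryE) (rule that, blast+)
  have eq: "lapp D (x' t) = lapp F (x t)" if "t \<ge> 0" for t
    using Gv[OF that] input[OF that] by simp
  obtain \<sigma>1 where \<sigma>1: "\<And>s. Re s > \<sigma>1 \<Longrightarrow> boundedly_invertible (pencil s D F)"
    using inv unfolding pencil_invertible_def by blast
  obtain \<sigma>2 where \<sigma>2: "\<And>s. s > \<sigma>2 \<Longrightarrow> (\<lambda>t. exp (- s * t) *\<^sub>R lapp D (x' t)) integrable_on {0..}"
    using laplace_transformable_real[OF lap] by blast
  \<comment> \<open>The growth bound needs a positive exponent inside the half-plane where the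
    transform exists.\<close>
  define s0 where "s0 = max 1 (\<sigma>2 + 1)"
  have s0: "s0 > 0" "s0 > \<sigma>2" by (auto simp: s0_def)
  have Dx0: "lapp D (x 0) = 0" using lin x0 by (simp add: linear_op_0)
  obtain M where M: "\<And>t. t \<ge> 0 \<Longrightarrow> norm (lapp D (x t)) \<le> M * exp (s0 * t)"
    using antiderivative_exp_bound[OF Dx' Dx0 s0(1) \<sigma>2[OF s0(2)]] by blast
  have contx: "continuous_on {0..} x"
    using x' by (auto simp: continuous_on_eq_continuous_within
        intro: has_vector_derivative_continuous)
  show ?thesis
  proof (rule Lerch[OF contx _ \<open>t \<ge> 0\<close>])
    fix s assume "s > max \<sigma>1 s0"
    then have s: "s > \<sigma>1" "s > s0" by auto
    obtain R where R: "bounded_linear R"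
      and Rx: "\<And>x. x \<in> ldom D \<Longrightarrow> x \<in> ldom F \<Longrightarrow> R (s *\<^sub>R lapp D x - lapp F x) = x"
      using real_resolvent[OF lin \<sigma>1[of "of_real s"]] s by auto
    interpret R: bounded_linear R by fact
    have eqI: "integral {0..b} (\<lambda>t. exp (- s * t) *\<^sub>R x t) = R (- (exp (- s * b) *\<^sub>R lapp D (x b)))"
      if "b \<ge> 0" for b
    proof -
      \<comment> \<open>The integrand is the exact derivative of the weighted \<open>D x\<close>,
        and the boundary term at 0 vanishes with the initial state.\<close>
      have "((\<lambda>t. - (exp (- s * t) *\<^sub>R (s *\<^sub>R lapp D (x t) - lapp D (x' t)))) has_integral
          exp (- s * b) *\<^sub>R lapp D (x b) - exp (- s * 0) *\<^sub>R lapp D (x 0)) {0..b}"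
      proof (rule FTC_atLeast[OF _ that])
        fix t :: real assume "t \<ge> 0"
        show "((\<lambda>t. exp (- s * t) *\<^sub>R lapp D (x t)) has_vector_derivative
            - (exp (- s * t) *\<^sub>R (s *\<^sub>R lapp D (x t) - lapp D (x' t)))) (at t within {0..})"
          by (rule derivative_eq_intros Dx'[OF \<open>t \<ge> 0\<close>] refl)+ (simp add: algebra_simps)
      qed
      \<comment> \<open>Only the bounded operator \<open>R\<close> is moved through the integral;
        \<open>D\<close> and \<open>F\<close>, possibly unbounded, are never moved.\<close>
      from has_integral_linear[OF has_integral_neg[OF this] R]
      have "((\<lambda>t. R (exp (- s * t) *\<^sub>R (s *\<^sub>R lapp D (x t) - lapp D (x' t)))) has_integral
          R (- (exp (- s * b) *\<^sub>R lapp D (x b)))) {0..b}"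
        by (simp add: o_def Dx0)
      moreover have "R (exp (- s * t) *\<^sub>R (s *\<^sub>R lapp D (x t) - lapp D (x' t))) = exp (- s * t) *\<^sub>R x t"
        if "t \<in> {0..b}" for t
        using that dom by (simp add: R.scaleR eq Rx)
      ultimately have "((\<lambda>t. exp (- s * t) *\<^sub>R x t) has_integral
          R (- (exp (- s * b) *\<^sub>R lapp D (x b)))) {0..b}"
        by (metis (no_types, lifting) has_integral_cong)
      then show ?thesis by (rule integral_unique)
    qed
    have "((\<lambda>b. exp (- s * b) *\<^sub>R lapp D (x b)) \<longlongrightarrow> 0) at_top"
    proof (rule tendsto_0_le)
      \<comment> \<open>The strict inequality between \<open>s\<close> and \<open>s0\<close> leaves
        a decaying factor after the growth \<open>exp (s0 * b)\<close> is absorbed.\<close>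
      show "((\<lambda>b. exp (- ((s - s0) * b))) \<longlongrightarrow> 0) at_top"
        using s by (intro filterlim_compose[OF exp_at_bot]
            filterlim_compose[OF filterlim_uminus_at_bot_at_top]
            filterlim_tendsto_pos_mult_at_top[OF tendsto_const] filterlim_ident) auto
      show "\<forall>\<^sub>F b in at_top. norm (exp (- s * b) *\<^sub>R lapp D (x b)) \<le> norm (exp (- ((s - s0) * b))) * M"
        using eventually_ge_at_top[of 0]
      proof eventually_elim
        fix b :: real assume "0 \<le> b"
        have "norm (exp (- s * b) *\<^sub>R lapp D (x b)) \<le> exp (- s * b) * (M * exp (s0 * b))"
          using M[OF \<open>0 \<le> b\<close>] by simp
        also have "\<dots> = exp (- ((s - s0) * b)) * M"
          by (simp add: algebra_simps flip: exp_add)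
        finally show "norm (exp (- s * b) *\<^sub>R lapp D (x b)) \<le> norm (exp (- ((s - s0) * b))) * M"
          by simp
      qed
    qed
    from R.tendsto[OF tendsto_minus[OF this]]
    have "((\<lambda>b. R (- (exp (- s * b) *\<^sub>R lapp D (x b)))) \<longlongrightarrow> 0) at_top"
      by (simp add: R.zero)
    then show "((\<lambda>b. integral {0..b} (\<lambda>t. exp (- s * t) *\<^sub>R x t)) \<longlongrightarrow> 0) at_top"
      by (rule Lim_transform_eventually)
        (use eventually_ge_at_top[of 0] in \<open>eventually_elim, simp only: eqI\<close>)
  qed
qed

section \<open>Passage between block trajectories and trajectories of a single block\<close>

lemma bounded_linear_axis: "bounded_linear (axis i :: 'a::real_normed_vector \<Rightarrow> 'a ^ 'n::finite)"
proof (rule bounded_linear_intro)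
  show "axis i (x + y) = axis i x + axis i y" for x y :: 'a by (simp add: axis_def vec_eq_iff)
  show "axis i (r *\<^sub>R x) = r *\<^sub>R axis i x" for r and x :: 'a by (simp add: axis_def vec_eq_iff)
  show "norm (axis i x :: 'a ^ 'n) \<le> norm x * 1" for x
    by (simp add: norm_vec_def L2_set_def axis_def if_distrib[of norm] if_distrib[of "\<lambda>u. u\<^sup>2"] cong: if_cong)
qed

lemma ldom_D_block: "x \<in> ldom (D_block E) \<longleftrightarrow> (\<forall>i. x $ i \<in> ldom E)"
  unfolding D_block_def block_op_def by (auto simp: zero_op_def split: if_splits)

lemma lapp_D_block: "lapp (D_block E) x = (\<chi> i. lapp E (x $ i))"
proof -
  have "lapp (if i = j then E else zero_op) (x $ j) = (if i = j then lapp E (x $ i) else 0)" for i j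
    by (simp add: zero_op_def)
  then show ?thesis unfolding D_block_def block_op_def by simp
qed

lemma ldom_F_block_nth:
  "x \<in> ldom (F_block blk A0 A1) \<Longrightarrow> x $ i \<in> ldom A0"
  unfolding F_block_def block_op_def by (auto dest!: spec[of _ i])

text \<open>Row \<open>i\<close> couples only to its own block and the one before; if the latter
  vanishes, only the diagonal term is left. For block number 0 the last assumption is
  vacuous.\<close>

lemma lapp_F_block_nth:
  fixes blk :: "'n::finite \<Rightarrow> nat"
  assumes "inj blk" and "lapp A1 0 = 0" and "\<And>j. blk i = blk j + 1 \<Longrightarrow> x $ j = 0"
  shows "lapp (F_block blk A0 A1) x $ i = lapp A0 (x $ i)"
proof -
  have "lapp (if blk i = blk j then A0 else if blk i = blk j + 1 then A1 else zero_op) (x $ j) =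
      (if i = j then lapp A0 (x $ i) else 0)" for j
    using assms by (auto simp: zero_op_def dest: injD)
  then show ?thesis unfolding F_block_def block_op_def by simp
qed

text \<open>Projection to a coordinate is bounded and linear, so it preserves derivatives and
  transforms, while \<open>pre\<close> removes the coupling from row \<open>i\<close>.\<close>

lemma zero_state_trajectory_block_nth:
  fixes blk :: "'n::finite \<Rightarrow> nat" and x :: "real \<Rightarrow> 'x::real_normed_vector ^ 'n"
  assumes "inj blk" and "lapp A1 0 = 0"
    and pre: "\<And>j t. blk i = blk j + 1 \<Longrightarrow> t \<ge> 0 \<Longrightarrow> x t $ j = 0"
    and traj: "zero_state_trajectory (D_block E) (F_block blk A0 A1) (block_diag B) x v"
  shows "zero_state_trajectory E A0 B (\<lambda>t. x t $ i) (\<lambda>t. v t $ i)"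
proof -
  note nth = bounded_linear_vec_nth[of i]
  obtain x' where x0: "x 0 = 0"
    and x': "\<And>t. t \<ge> 0 \<Longrightarrow> (x has_vector_derivative x' t) (at t within {0..})"
    and dom: "\<And>t. t \<ge> 0 \<Longrightarrow> x t \<in> ldom (D_block E)" "\<And>t. t \<ge> 0 \<Longrightarrow> x' t \<in> ldom (D_block E)"
      "\<And>t. t \<ge> 0 \<Longrightarrow> x t \<in> ldom (F_block blk A0 A1)"
    and Dx': "\<And>t. t \<ge> 0 \<Longrightarrow> ((\<lambda>t. lapp (D_block E) (x t)) has_vector_derivative
        lapp (D_block E) (x' t)) (at t within {0..})"
    and eq: "\<And>t. t \<ge> 0 \<Longrightarrow>
        lapp (D_block E) (x' t) = lapp (F_block blk A0 A1) (x t) + block_diag B (v t)"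
    and lap: "laplace_transformable x" "laplace_transformable (\<lambda>t. lapp (D_block E) (x' t))"
      "laplace_transformable v"
    using traj by (rule zero_state_trajectoryE) (rule that, blast+)
  have "lapp E (x' t $ i) = lapp A0 (x t $ i) + B (v t $ i)" if "t \<ge> 0" for t
  proof -
    have "lapp (F_block blk A0 A1) (x t) $ i = lapp A0 (x t $ i)"
      using assms that by (intro lapp_F_block_nth) auto
    with arg_cong[OF eq[OF that], of "\<lambda>y. y $ i"] show ?thesis
      by (simp add: lapp_D_block block_diag_def)
  qed
  moreover have "((\<lambda>t. lapp E (x t $ i)) has_vector_derivative lapp E (x' t $ i)) (at t within {0..})"
    if "t \<ge> 0" for t
    using bounded_linear.has_vector_derivative[OF nth Dx'[OF that]] by (simp add: lapp_D_block)
  moreover have "laplace_transformable (\<lambda>t. lapp E (x' t $ i))"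
    using laplace_transformable_linear[OF lap(2) nth] by (simp add: lapp_D_block)
  ultimately show ?thesis
    unfolding zero_state_trajectory_def
    using x0 dom(1,2)[unfolded ldom_D_block] ldom_F_block_nth[OF dom(3)]
    by (intro conjI exI[of _ "\<lambda>t. x' t $ i"] allI impI laplace_transformable_linear[OF _ nth] lap
          bounded_linear.has_vector_derivative[OF nth] x') simp_all
qed

text \<open>The last block feeds into no further row, so the remaining blocks can stay at
  zero.\<close>

lemma zero_state_trajectory_axis:
  fixes blk :: "'n::finite \<Rightarrow> nat" and x :: "real \<Rightarrow> 'x::real_normed_vector"
  assumes "inj blk" and last: "\<And>i. blk i \<le> blk m"
    and E: "linear_op E" and A0: "linear_op A0" and A1: "linear_op A1" and B: "B 0 = 0"
    and traj: "zero_state_trajectory E A0 B x v"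
  shows "zero_state_trajectory (D_block E) (F_block blk A0 A1) (block_diag B)
    (\<lambda>t. axis m (x t)) (\<lambda>t. axis m (v t))"
proof -
  obtain x' where x0: "x 0 = 0"
    and x': "\<And>t. t \<ge> 0 \<Longrightarrow> (x has_vector_derivative x' t) (at t within {0..})"
    and dom: "\<And>t. t \<ge> 0 \<Longrightarrow> x t \<in> ldom E" "\<And>t. t \<ge> 0 \<Longrightarrow> x' t \<in> ldom E"
      "\<And>t. t \<ge> 0 \<Longrightarrow> x t \<in> ldom A0"
    and Dx': "\<And>t. t \<ge> 0 \<Longrightarrow> ((\<lambda>t. lapp E (x t)) has_vector_derivative
        lapp E (x' t)) (at t within {0..})"
    and eq: "\<And>t. t \<ge> 0 \<Longrightarrow> lapp E (x' t) = lapp A0 (x t) + B (v t)"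
    and lap: "laplace_transformable x" "laplace_transformable (\<lambda>t. lapp E (x' t))"
      "laplace_transformable v"
    using traj by (rule zero_state_trajectoryE) (rule that, blast+)
  have D: "lapp (D_block E) (axis m y) = axis m (lapp E y)" for y
    using linear_op_0[OF E] by (simp add: lapp_D_block axis_def vec_eq_iff)
  have Ddom: "axis m y \<in> ldom (D_block E)" if "y \<in> ldom E" for y
    using linear_op_0[OF E] that by (simp add: ldom_D_block axis_def)
  \<comment> \<open>Hence \<open>A1\<close> never acts on component \<open>m\<close>, and the
    embedded state lies in the domain of the block operator without belonging to
    \<open>ldom A1\<close>.\<close>
  have not_above: "blk i \<noteq> blk m + 1" for i using last[of i] by simp
  have Fdom: "axis m y \<in> ldom (F_block blk A0 A1)" if "y \<in> ldom A0" for y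
    unfolding F_block_def block_op_def
    using linear_op_0(1)[OF A0] linear_op_0(1)[OF A1] that not_above
    by (auto simp: axis_def zero_op_def)
  have F: "lapp (F_block blk A0 A1) (axis m y) = axis m (lapp A0 y)" for y
  proof -
    have "lapp (F_block blk A0 A1) (axis m y) $ i = lapp A0 (axis m y $ i)" for i
      using \<open>inj blk\<close> not_above linear_op_0(2)[OF A1]
      by (intro lapp_F_block_nth) (auto simp: axis_def)
    then show ?thesis using linear_op_0(2)[OF A0] by (simp add: vec_eq_iff axis_def)
  qed
  have G: "block_diag B (axis m u) = axis m (B u)" for u
    using B by (simp add: block_diag_def axis_def vec_eq_iff)
  note ax = bounded_linear_axis[of m]
  have add: "axis m (a + b) = axis m a + axis m b" for a b :: 'x
    using ax by (rule linear_add[OF bounded_linear.linear])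
  show ?thesis
    unfolding zero_state_trajectory_def D F G add[symmetric]
    by (intro conjI exI[of _ "\<lambda>t. axis m (x' t)"] allI impI laplace_transformable_linear[OF _ ax]
          lap Ddom Fdom x' dom bounded_linear.has_vector_derivative[OF ax])
      (simp_all add: D F x0 bounded_linear.has_vector_derivative[OF ax Dx']
          laplace_transformable_linear[OF lap(2) ax] flip: add eq)
qed

section \<open>The equivalence for general lower bidiagonal block systems\<close>

theorem left_invertible_block_iff:
  fixes E A0 A1 :: "('x::{real_inner, banach}, 'x) linop"
    and B :: "'v::real_normed_vector \<Rightarrow> 'x" and C :: "'x \<Rightarrow> 'y::real_normed_vector"
    and blk :: "'n::finite \<Rightarrow> nat"
  assumes E: "linear_op E" and A0: "linear_op A0" and A1: "linear_op A1"
    and B: "B 0 = 0" and C: "C 0 = 0"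
    and inj: "inj blk" and last: "\<And>i. blk i \<le> blk m" and inv: "pencil_invertible E A0"
  shows "left_invertible (D_block E) (F_block blk A0 A1) (block_diag B) (block_diag C)
    \<longleftrightarrow> left_invertible E A0 B C" (is "?block \<longleftrightarrow> ?sub")
proof
  assume ?block
  show ?sub
    unfolding left_invertible_def
  proof (intro allI impI)
    fix x v and t :: real
    assume "zero_state_trajectory E A0 B x v" and out: "\<forall>t\<ge>0. C (x t) = 0" and "t \<ge> 0"
    then have "zero_state_trajectory (D_block E) (F_block blk A0 A1) (block_diag B)
        (\<lambda>t. axis m (x t)) (\<lambda>t. axis m (v t))"
      using assms by (intro zero_state_trajectory_axis)
    moreover have "\<forall>t\<ge>0. block_diag C (axis m (x t)) = 0"
      using C out by (simp add: block_diag_def axis_def vec_eq_iff)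
    ultimately have "axis m (v t) = 0"
      using \<open>?block\<close> \<open>t \<ge> 0\<close> unfolding left_invertible_def by blast
    then show "v t = 0" by simp
  qed
next
  assume ?sub
  show ?block
    unfolding left_invertible_def
  proof (intro allI impI)
    fix x v and t :: real
    assume traj: "zero_state_trajectory (D_block E) (F_block blk A0 A1) (block_diag B) x v"
      and out: "\<forall>t\<ge>0. block_diag C (x t) = 0" and "t \<ge> 0"
    \<comment> \<open>The induction on block numbers carries the state along with the input, since
      the next row is decoupled only when the previous state block is zero.\<close>
    have "\<forall>t\<ge>0. x t $ i = 0 \<and> v t $ i = 0" for i
    proof (induction i rule: measure_induct_rule[of blk])
      case (less i)
      then have pre: "x t $ j = 0" if "blk i = blk j + 1" "t \<ge> 0" for j t
        using that by simp
      have sub: "zero_state_trajectory E A0 B (\<lambda>t. x t $ i) (\<lambda>t. v t $ i)"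
        using inj linear_op_0(2)[OF A1] pre traj by (rule zero_state_trajectory_block_nth)
      moreover have "\<forall>t\<ge>0. C (x t $ i) = 0"
        using out by (simp add: block_diag_def vec_eq_iff)
      ultimately have "\<forall>t\<ge>0. v t $ i = 0"
        using \<open>?sub\<close> unfolding left_invertible_def by blast
      with zero_input_zero_state[OF E A0 inv sub] show ?case by (simp add: B)
    qed
    with \<open>t \<ge> 0\<close> show "v t = 0" by (simp add: vec_eq_iff)
  qed
qed

section \<open>Specialisation to the first-order form of the second-order system\<close>

lemma linear_op_E_tilde: "linear_op E \<Longrightarrow> linear_op (E_tilde E)"
  by (auto simp: linear_op_def E_tilde_def subspace_def zero_prod_def)

lemma linear_op_A0_tilde: "linear_op A0 \<Longrightarrow> linear_op (A0_tilde A0 \<alpha>)"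
  by (auto simp: linear_op_def A0_tilde_def subspace_def zero_prod_def algebra_simps)

lemma linear_op_A1_tilde: "linear_op A1 \<Longrightarrow> linear_op (A1_tilde A1)"
  by (auto simp: linear_op_def A1_tilde_def subspace_def zero_prod_def algebra_simps)

theorem proposition3p2:
  fixes E A0 A1 :: "('h::{real_inner, banach}, 'h) linop"
    and B :: "'u::{real_inner, banach} \<Rightarrow> 'h"
    and C :: "'h \<Rightarrow> 'y::{real_inner, banach}"
    and \<alpha> :: real
    and k :: nat
    and blk :: "'n::finite \<Rightarrow> nat"
  assumes "\<alpha> \<ge> 0"
    and "linear_op E" and "linear_op A0" and "linear_op A1"
    and "bounded_linear B" and "bounded_linear C"
    and "bij_betw blk UNIV {..k}"
    and "pencil_invertible
           (D_block (E_tilde E) :: (('h \<times> 'h) ^ 'n, ('h \<times> 'h) ^ 'n) linop)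
           (F_block blk (A0_tilde A0 \<alpha>) (A1_tilde A1))"
    and "pencil_invertible (E_tilde E) (A0_tilde A0 \<alpha>)"
  shows "left_invertible
           (D_block (E_tilde E) :: (('h \<times> 'h) ^ 'n, ('h \<times> 'h) ^ 'n) linop)
           (F_block blk (A0_tilde A0 \<alpha>) (A1_tilde A1))
           (block_diag (B_tilde B))
           (block_diag (C_tilde C))
         \<longleftrightarrow>
         left_invertible (E_tilde E) (A0_tilde A0 \<alpha>) (B_tilde B) (C_tilde C)"
proof -
  \<comment> \<open>The index \<open>m\<close> with block number \<open>k\<close> is the last block,
    where a trajectory of the subsystem is placed.\<close>
  have "k \<in> range blk" using assms(7) by (auto simp: bij_betw_def)
  then obtain m where "blk m = k" by blast
  then have "blk i \<le> blk m" for i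
    using bij_betwE[OF assms(7)] by auto
  moreover have "B_tilde B 0 = 0" "C_tilde C 0 = 0"
    using assms(5,6) by (auto simp: B_tilde_def C_tilde_def zero_prod_def linear_simps)
  ultimately show ?thesis
    using assms
    by (intro left_invertible_block_iff linear_op_E_tilde linear_op_A0_tilde linear_op_A1_tilde)
       (auto simp: bij_betw_def)
qed

end
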